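(* Let \(\Gamma\) be an oriented graph or a \(2\)-edge-coloured graph. Then \(\Gamma\) admits no improper homomorphism (to any reflexive oriented graph, respectively to any reflexive \(2\)-edge-coloured graph) if and only if \(\Gamma\) is complete convex.
   Context: Graphs have no parallel edges, are connected and have at least two vertices; loops are permitted unless stated otherwise. An oriented graph arises from a graph by giving each edge a direction (an anti-symmetric digraph); a \(2\)-edge-coloured graph is a pair \((G,c_G)\) with \(c_G:E_G\to\{R,B\}\). A reflexive oriented graph has a loop at every vertex; a reflexive \(2\)-edge-coloured graph has a loop of each colour at every vertex. A homomorphism of oriented graphs \(\phi:\vec G\to\vec H\) is a map \(V_G\to V_H\) with \(\phi(u)\phi(v)\in A_{\vec H}\) for every arc \(uv\in A_{\vec G}\); a homomorphism of \(2\)-edge-coloured graphs is a vertex map preserving edges and their colours. For a reflexive target, a homomorphism is trivial if the induced map on arcs (edges) sends every arc (edge) to the same loop; improper if it is not trivial and sends at least one arc (edge) to a loop; proper if it sends no arc (edge) to a loop. In an oriented graph, \(u,v,w\) is a \(2\)-dipath with centre \(v\) if \(uv,vw\) are arcs, \(u\ne v\), \(v\ne w\). In a \(2\)-edge-coloured graph, \(u,v,w\) with \(uv,vw\) edges, \(u\ne v\ne w\), is an alternating \(2\)-path with centre \(v\) if \(c(uv)\ne c(vw)\). A set \(S\) of vertices is convex if no vertex outside \(S\) is the centre of a \(2\)-dipath (resp. alternating \(2\)-path) with both ends in \(S\); \(conv(S)\) is the smallest convex set containing \(S\), and \(conv(uv)=conv(\{u,v\})\). \(\Gamma\) is complete convex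 if \(conv(uv)=V_\Gamma\) for every arc (edge) \(uv\) of \(\Gamma\).
   Formalization: For 2-edge-coloured graphs, "the same loop" in the definition of a trivial homomorphism is taken to mean loops at the same vertex regardless of colour; otherwise a constant map on a complete convex graph with both colours would be improper and the claim would fail. *)

theory Defs
  imports "Graph_Theory.Digraph_Component"
begin

section \<open>Convexity\<close>

text \<open>
  Both kinds of graphs use the same notion of convexity, relative to the ternary relation
  \<open>P u v w\<close> which says that \<open>u, v, w\<close> is a 2-dipath (an alternating 2-path) with centre \<open>v\<close>.
\<close>

definition path_convex :: "'a set \<Rightarrow> ('a \<Rightarrow> 'a \<Rightarrow> 'a \<Rightarrow> bool) \<Rightarrow> 'a set \<Rightarrow> bool" where
  "path_convex V P S \<longleftrightarrow> S \<subseteq> V \<and> \<not> (\<exists>v \<in> V - S. \<exists>u \<in> S. \<exists>w \<in> S. P u v w)"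

definition conv :: "'a set \<Rightarrow> ('a \<Rightarrow> 'a \<Rightarrow> 'a \<Rightarrow> bool) \<Rightarrow> 'a set \<Rightarrow> 'a set" where
  "conv V P S = \<Inter> {T. path_convex V P T \<and> S \<subseteq> T}"

lemma conv_smallest_convex:
  assumes "S \<subseteq> V"
  shows "path_convex V P (conv V P S)" and "S \<subseteq> conv V P S"
    and "\<And>T. path_convex V P T \<Longrightarrow> S \<subseteq> T \<Longrightarrow> conv V P S \<subseteq> T"
proof -
  have "path_convex V P V" by (simp add: path_convex_def)
  then have sub: "conv V P S \<subseteq> V" using assms by (auto simp: conv_def)
  have "False" if v: "v \<in> V" "v \<notin> conv V P S" and uw: "u \<in> conv V P S" "w \<in> conv V P S" "P u v w"
    for u v w
  proof -
    obtain T where T: "path_convex V P T" "S \<subseteq> T" "v \<notin> T"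
      using v(2) by (auto simp: conv_def)
    then have "u \<in> T" "w \<in> T" using uw(1,2) by (auto simp: conv_def)
    with T v(1) uw(3) show False unfolding path_convex_def by blast
  qed
  with sub show "path_convex V P (conv V P S)"
    unfolding path_convex_def by (meson DiffD1 DiffD2)
qed (auto simp: conv_def)


section \<open>Oriented graphs\<close>

text \<open>Loops are allowed: \<open>pair_wf_digraph\<close> only requires the ends of arcs to be vertices.\<close>

definition oriented_graph :: "'a pair_pre_digraph \<Rightarrow> bool" where
  "oriented_graph G \<longleftrightarrow>
     pair_wf_digraph G \<and> antisym (parcs G) \<and> connected (with_proj G) \<and>
     (\<exists>u \<in> pverts G. \<exists>v \<in> pverts G. u \<noteq> v)"

definition reflexive_oriented_graph :: "'a pair_pre_digraph \<Rightarrow> bool" where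
  "reflexive_oriented_graph G \<longleftrightarrow> oriented_graph G \<and> (\<forall>v \<in> pverts G. (v, v) \<in> parcs G)"

definition oriented_hom ::
    "('a \<Rightarrow> 'b) \<Rightarrow> 'a pair_pre_digraph \<Rightarrow> 'b pair_pre_digraph \<Rightarrow> bool" where
  "oriented_hom \<phi> G H \<longleftrightarrow>
     \<phi> ` pverts G \<subseteq> pverts H \<and> (\<forall>(u, v) \<in> parcs G. (\<phi> u, \<phi> v) \<in> parcs H)"

definition trivial_oriented_hom ::
    "('a \<Rightarrow> 'b) \<Rightarrow> 'a pair_pre_digraph \<Rightarrow> 'b pair_pre_digraph \<Rightarrow> bool" where
  "trivial_oriented_hom \<phi> G H \<longleftrightarrow>
     oriented_hom \<phi> G H \<and> (\<exists>x \<in> pverts H. \<forall>(u, v) \<in> parcs G. (\<phi> u, \<phi> v) = (x, x))"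

definition improper_oriented_hom ::
    "('a \<Rightarrow> 'b) \<Rightarrow> 'a pair_pre_digraph \<Rightarrow> 'b pair_pre_digraph \<Rightarrow> bool" where
  "improper_oriented_hom \<phi> G H \<longleftrightarrow>
     oriented_hom \<phi> G H \<and> \<not> trivial_oriented_hom \<phi> G H \<and>
     (\<exists>(u, v) \<in> parcs G. \<exists>x \<in> pverts H. (\<phi> u, \<phi> v) = (x, x))"

definition two_dipath :: "'a pair_pre_digraph \<Rightarrow> 'a \<Rightarrow> 'a \<Rightarrow> 'a \<Rightarrow> bool" where
  "two_dipath G u v w \<longleftrightarrow> (u, v) \<in> parcs G \<and> (v, w) \<in> parcs G \<and> u \<noteq> v \<and> v \<noteq> w"

definition complete_convex_oriented :: "'a pair_pre_digraph \<Rightarrow> bool" where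
  "complete_convex_oriented G \<longleftrightarrow>
     (\<forall>(u, v) \<in> parcs G. conv (pverts G) (two_dipath G) {u, v} = pverts G)"


section \<open>2-edge-coloured graphs\<close>

datatype colour = Red | Blue

text \<open>
  An edge is stored together with its colour, as a pair \<open>({u, v}, c)\<close>; a loop at \<open>v\<close> of colour
  \<open>c\<close> is \<open>({v}, c)\<close>.
\<close>

record 'a coloured_graph =
  cverts :: "'a set"
  cedges :: "('a set \<times> colour) set"

definition underlying :: "'a coloured_graph \<Rightarrow> 'a pair_pre_digraph" where
  "underlying G = \<lparr>pverts = cverts G, parcs = {(u, v). \<exists>c. ({u, v}, c) \<in> cedges G}\<rparr>"

text \<open>
  On edges with distinct ends, the set of edges is the graph of a colouring function. A vertex may
  carry a loop of either colour or of both, because a reflexive 2-edge-coloured graph has both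
  loops at every vertex.
\<close>

definition two_edge_coloured_graph :: "'a coloured_graph \<Rightarrow> bool" where
  "two_edge_coloured_graph G \<longleftrightarrow>
     (\<forall>(e, c) \<in> cedges G. \<exists>u \<in> cverts G. \<exists>v \<in> cverts G. e = {u, v}) \<and>
     (\<forall>u v c d. u \<noteq> v \<longrightarrow> ({u, v}, c) \<in> cedges G \<longrightarrow> ({u, v}, d) \<in> cedges G \<longrightarrow> c = d) \<and>
     connected (with_proj (underlying G)) \<and>
     (\<exists>u \<in> cverts G. \<exists>v \<in> cverts G. u \<noteq> v)"

definition reflexive_two_edge_coloured_graph :: "'a coloured_graph \<Rightarrow> bool" where
  "reflexive_two_edge_coloured_graph G \<longleftrightarrow>
     two_edge_coloured_graph G \<and> (\<forall>v \<in> cverts G. \<forall>c. ({v}, c) \<in> cedges G)"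

definition coloured_hom ::
    "('a \<Rightarrow> 'b) \<Rightarrow> 'a coloured_graph \<Rightarrow> 'b coloured_graph \<Rightarrow> bool" where
  "coloured_hom \<phi> G H \<longleftrightarrow>
     \<phi> ` cverts G \<subseteq> cverts H \<and> (\<forall>(e, c) \<in> cedges G. (\<phi> ` e, c) \<in> cedges H)"

text \<open>
  The red and the blue loop at a vertex count as the same loop when deciding triviality. Otherwise a
  constant map on a graph with edges of both colours would not be trivial, and every graph with
  edges of both colours would admit an improper homomorphism.
\<close>

definition trivial_coloured_hom ::
    "('a \<Rightarrow> 'b) \<Rightarrow> 'a coloured_graph \<Rightarrow> 'b coloured_graph \<Rightarrow> bool" where
  "trivial_coloured_hom \<phi> G H \<longleftrightarrow>
     coloured_hom \<phi> G H \<and> (\<exists>x \<in> cverts H. \<forall>(e, c) \<in> cedges G. \<phi> ` e = {x})"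

definition improper_coloured_hom ::
    "('a \<Rightarrow> 'b) \<Rightarrow> 'a coloured_graph \<Rightarrow> 'b coloured_graph \<Rightarrow> bool" where
  "improper_coloured_hom \<phi> G H \<longleftrightarrow>
     coloured_hom \<phi> G H \<and> \<not> trivial_coloured_hom \<phi> G H \<and>
     (\<exists>(e, c) \<in> cedges G. \<exists>x \<in> cverts H. \<phi> ` e = {x})"

definition alternating_two_path :: "'a coloured_graph \<Rightarrow> 'a \<Rightarrow> 'a \<Rightarrow> 'a \<Rightarrow> bool" where
  "alternating_two_path G u v w \<longleftrightarrow>
     u \<noteq> v \<and> v \<noteq> w \<and> (\<exists>c d. ({u, v}, c) \<in> cedges G \<and> ({v, w}, d) \<in> cedges G \<and> c \<noteq> d)"

definition complete_convex_coloured :: "'a coloured_graph \<Rightarrow> bool" where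
  "complete_convex_coloured G \<longleftrightarrow>
     (\<forall>(e, c) \<in> cedges G. conv (cverts G) (alternating_two_path G) e = cverts G)"


section \<open>Existence of improper homomorphisms\<close>

text \<open>
  HOL cannot quantify over types within a formula, so the type of the vertices of the target is a
  parameter.
\<close>

definition oriented_improper_hom_exists :: "'b itself \<Rightarrow> 'a pair_pre_digraph \<Rightarrow> bool" where
  "oriented_improper_hom_exists (_ :: 'b itself) G \<longleftrightarrow>
     (\<exists>(H :: 'b pair_pre_digraph) \<phi>. reflexive_oriented_graph H \<and> improper_oriented_hom \<phi> G H)"

definition coloured_improper_hom_exists :: "'b itself \<Rightarrow> 'a coloured_graph \<Rightarrow> bool" where
  "coloured_improper_hom_exists (_ :: 'b itself) G \<longleftrightarrow>
     (\<exists>(H :: 'b coloured_graph) \<phi>.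
        reflexive_two_edge_coloured_graph H \<and> improper_coloured_hom \<phi> G H)"

end

theory Submission
  imports Defs
begin

text \<open>
  If a homomorphism sends an edge \<open>uv\<close> to a loop at \<open>x\<close>, then the fibre of \<open>x\<close> is convex: a vertex
  outside it joined to it by arcs in both directions (by edges of both colours) would be mapped to
  a vertex joined in the same way to \<open>x\<close>, which the target does not allow. So the fibre contains
  \<open>conv(uv)\<close>. Conversely, if \<open>conv(uv)\<close> is not the whole vertex set, it can be contracted to a
  single vertex: by convexity every outside vertex is joined to it in only one direction (by only one
  colour), hence the quotient is again a graph and the quotient map is improper.
\<close>

section \<open>Contraction maps, images of connected graphs, hulls\<close>

text \<open>Choosing a representative \<open>u\<close> for the class \<open>S\<close> keeps the
  quotient on the vertex type of the given graph.\<close>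

definition contract :: "'a set \<Rightarrow> 'a \<Rightarrow> 'a \<Rightarrow> 'a" where
  "contract S u x = (if x \<in> S then u else x)"

lemma contract_in [simp]: "x \<in> S \<Longrightarrow> contract S u x = u"
  and contract_notin [simp]: "x \<notin> S \<Longrightarrow> contract S u x = x"
  by (simp_all add: contract_def)

text \<open>For \<open>u\<close> in \<open>S\<close>, the fibres are \<open>S\<close> and the
  singletons outside it; an outside \<open>u\<close> would itself be merged with
  \<open>S\<close>.\<close>

lemma contract_eq_iff:
  "u \<in> S \<Longrightarrow> contract S u x = contract S u y \<longleftrightarrow> x = y \<or> x \<in> S \<and> y \<in> S"
  by (auto simp: contract_def)

lemma in_parcs_mk_symmetric_iff:
  "(u, v) \<in> parcs (mk_symmetric (with_proj G)) \<longleftrightarrow> (u, v) \<in> parcs G \<or> (v, u) \<in> parcs G"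
  by (simp add: parcs_mk_symmetric) (metis fst_conv prod.collapse snd_conv)

text \<open>Walks are mapped step by step; surjectivity on vertices makes every pair in
  \<open>H\<close> an image of a pair in \<open>G\<close>.\<close>

lemma connected_image:
  assumes "connected (with_proj G)" and "pverts H = \<phi> ` pverts G"
    and arcs: "\<And>u v. (u, v) \<in> parcs G \<Longrightarrow> (\<phi> u, \<phi> v) \<in> parcs H"
  shows "connected (with_proj H)"
proof -
  let ?R = "\<lambda>K. rtrancl_on (pverts K) (parcs (mk_symmetric (with_proj K)))"
  have "(\<phi> a, \<phi> b) \<in> ?R H" if "(a, b) \<in> ?R G" for a b
    using that
  proof (induct rule: rtrancl_on_induct)
    case base
    then show ?case using assms(2) by auto
  next
    case (step y z)
    then have "(\<phi> y, \<phi> z) \<in> parcs (mk_symmetric (with_proj H))"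
      using arcs by (auto simp: in_parcs_mk_symmetric_iff)
    with step show ?case using assms(2) by (auto intro: rtrancl_on_into_rtrancl_on)
  qed
  then show ?thesis
    using assms(1,2) by (auto simp: connected_def strongly_connected_def reachable_def)
qed

text \<open>Takes the first step of a walk from \<open>u\<close> to \<open>v\<close>. Triviality
  constrains only arcs, so a vertex outside the contracted set needs an incident arc to witness
  non-triviality.\<close>

lemma connected_vertex_incident:
  assumes "connected (with_proj G)" "u \<in> pverts G" "v \<in> pverts G" "u \<noteq> v"
  obtains w where "(u, w) \<in> parcs G \<or> (w, u) \<in> parcs G"
proof -
  have "(u, v) \<in> rtrancl_on (pverts G) (parcs (mk_symmetric (with_proj G)))"
    using assms by (auto simp: connected_def strongly_connected_def reachable_def)
  then obtain w where "(u, w) \<in> parcs (mk_symmetric (with_proj G))"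
    using \<open>u \<noteq> v\<close> by (cases rule: converse_rtrancl_on_cases) auto
  then show thesis
    using that by (auto simp: in_parcs_mk_symmetric_iff)
qed

lemma conv_proper_vertex:
  assumes "S \<subseteq> V" "conv V P S \<noteq> V"
  obtains z where "z \<in> V" "z \<notin> conv V P S"
  using assms conv_smallest_convex(1)[OF assms(1), of P] by (auto simp: path_convex_def)


section \<open>Oriented graphs\<close>

lemma complete_convex_oriented_no_improper:
  assumes D: "oriented_graph D" and cc: "complete_convex_oriented D"
  shows "\<not> oriented_improper_hom_exists TYPE('b) D"
proof
  assume "oriented_improper_hom_exists TYPE('b) D"
  then obtain H :: "'b pair_pre_digraph" and \<phi>
    where H: "reflexive_oriented_graph H" and imp: "improper_oriented_hom \<phi> D H"
    unfolding oriented_improper_hom_exists_def by blast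
  interpret pair_wf_digraph D using D by (simp add: oriented_graph_def)
  have anti: "antisym (parcs H)"
    using H by (simp add: reflexive_oriented_graph_def oriented_graph_def)
  have hom: "(\<phi> a, \<phi> b) \<in> parcs H" if "(a, b) \<in> parcs D" for a b
    using imp that by (auto simp: improper_oriented_hom_def oriented_hom_def)
  obtain u v x where uv: "(u, v) \<in> parcs D" "x \<in> pverts H" "\<phi> u = x" "\<phi> v = x"
    using imp by (auto simp: improper_oriented_hom_def)
  let ?F = "{a \<in> pverts D. \<phi> a = x}"
  have "path_convex (pverts D) (two_dipath D) ?F"
  proof -
    \<comment> \<open>The images are the arcs from \<open>x\<close> to \<open>\<phi> b\<close> and
      back, which antisymmetry allows only if both are the loop.\<close>
    have "\<phi> b = x" if "(a, b) \<in> parcs D" "(b, c) \<in> parcs D" "\<phi> a = x" "\<phi> c = x" for a b c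
      using hom[OF that(1)] hom[OF that(2)] that(3,4) antisymD[OF anti] by simp
    then show ?thesis unfolding path_convex_def two_dipath_def by blast
  qed
  moreover have "{u, v} \<subseteq> ?F" using uv in_arcsD1[OF uv(1)] in_arcsD2[OF uv(1)] by simp
  ultimately have "conv (pverts D) (two_dipath D) {u, v} \<subseteq> ?F"
    by (auto simp: conv_def)
  moreover have "conv (pverts D) (two_dipath D) {u, v} = pverts D"
    using cc uv by (auto simp: complete_convex_oriented_def)
  ultimately have "\<phi> a = x" if "a \<in> pverts D" for a
    using that by auto
  then have "\<forall>(a, b) \<in> parcs D. (\<phi> a, \<phi> b) = (x, x)"
    using in_arcsD1 in_arcsD2 by blast
  then have "trivial_oriented_hom \<phi> D H"
    using imp uv(2) unfolding improper_oriented_hom_def trivial_oriented_hom_def by blast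
  with imp show False by (simp add: improper_oriented_hom_def)
qed

lemma not_complete_convex_oriented_improper:
  fixes D :: "'a pair_pre_digraph"
  assumes D: "oriented_graph D" and ncc: "\<not> complete_convex_oriented D"
  shows "oriented_improper_hom_exists TYPE('a) D"
proof -
  interpret pair_wf_digraph D using D by (simp add: oriented_graph_def)
  obtain u v where uv: "(u, v) \<in> parcs D" "conv (pverts D) (two_dipath D) {u, v} \<noteq> pverts D"
    using ncc by (auto simp: complete_convex_oriented_def)
  \<comment> \<open>If \<open>uv\<close> is a loop, \<open>S\<close> is just \<open>{u}\<close> and
    the contraction is the identity; the argument covers this case uniformly.\<close>
  define S where "S = conv (pverts D) (two_dipath D) {u, v}"
  have sub: "{u, v} \<subseteq> pverts D" using uv in_arcsD1 in_arcsD2 by auto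
  obtain z where z: "z \<in> pverts D" "z \<notin> S"
    using conv_proper_vertex[OF sub uv(2)] by (auto simp: S_def)
  have uS: "u \<in> S" "v \<in> S" and conv: "path_convex (pverts D) (two_dipath D) S"
    using conv_smallest_convex(1,2)[OF sub] by (auto simp: S_def)
  have no_dipath: False if "(a, b) \<in> parcs D" "(b, c) \<in> parcs D" "a \<in> S" "c \<in> S" "b \<notin> S" for a b c
  proof -
    have "two_dipath D a b c" using that by (auto simp: two_dipath_def)
    then show False using conv that in_arcsD2 unfolding path_convex_def by blast
  qed
  let ?f = "contract S u"
  define H where "H = \<lparr>pverts = ?f ` pverts D,
    parcs = {(?f a, ?f b) | a b. (a, b) \<in> parcs D} \<union> {(x, x) | x. x \<in> ?f ` pverts D}\<rparr>"
  have "pair_wf_digraph H"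
    by unfold_locales (auto simp: H_def in_arcsD1 in_arcsD2)
  moreover have "antisym (parcs H)"
  proof (rule antisymI, rule ccontr)
    fix x y assume "(x, y) \<in> parcs H" "(y, x) \<in> parcs H" "x \<noteq> y"
    \<comment> \<open>As \<open>x\<close> and \<open>y\<close> differ, neither arc is an added loop,
      so both lift to \<open>D\<close>; the lifts agree only up to the classes of their
      ends.\<close>
    then obtain a b a' b' where arcs: "(a, b) \<in> parcs D" "(b', a') \<in> parcs D"
      and eq: "?f a = ?f a'" "?f b = ?f b'" and neq: "?f a \<noteq> ?f b"
      by (auto simp: H_def)
    have "a \<noteq> b" "\<not> (a \<in> S \<and> b \<in> S)" using neq by (auto simp: contract_eq_iff[OF uS(1)])
    moreover have "a = a' \<or> a \<in> S \<and> a' \<in> S" "b = b' \<or> b \<in> S \<and> b' \<in> S"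
      using eq by (auto simp: contract_eq_iff[OF uS(1)])
    moreover have "antisym (parcs D)" using D by (simp add: oriented_graph_def)
    \<comment> \<open>Either the lifts have the same ends, against antisymmetry of \<open>D\<close>,
      or one pair of ends lies in \<open>S\<close> and the other is a single vertex outside it, the
      centre of a forbidden 2-dipath.\<close>
    ultimately show False using arcs no_dipath by (metis antisymD)
  qed
  moreover have "connected (with_proj H)"
    using D by (intro connected_image[of D H ?f]) (auto simp: oriented_graph_def H_def)
  moreover have "u \<in> pverts H" "z \<in> pverts H" "u \<noteq> z"
    using sub uS z by (force simp: H_def)+
  moreover have "(x, x) \<in> parcs H" if "x \<in> pverts H" for x
    using that by (auto simp: H_def)
  ultimately have refl: "reflexive_oriented_graph H"
    by (auto simp: reflexive_oriented_graph_def oriented_graph_def)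
  obtain w where w: "(z, w) \<in> parcs D \<or> (w, z) \<in> parcs D"
    using connected_vertex_incident[of D z u] D sub z uS by (auto simp: oriented_graph_def)
  have "\<not> trivial_oriented_hom ?f D H"
  proof
    assume "trivial_oriented_hom ?f D H"
    then obtain x where const: "\<And>a b. (a, b) \<in> parcs D \<Longrightarrow> ?f a = x \<and> ?f b = x"
      unfolding trivial_oriented_hom_def by fast
    \<comment> \<open>Both \<open>u\<close> and \<open>z\<close> are ends of arcs, so a trivial map
      would identify them, although \<open>?f\<close> fixes both.\<close>
    then have "?f u = ?f z" using uv(1) w by metis
    then show False using uS z by auto
  qed
  moreover have "oriented_hom ?f D H"
    by (auto simp: oriented_hom_def H_def)
  moreover have "\<exists>(a, b) \<in> parcs D. \<exists>x \<in> pverts H. (?f a, ?f b) = (x, x)"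
    using uv uS \<open>u \<in> pverts H\<close> by (auto intro!: bexI[of _ "(u, v)"])
  ultimately have "improper_oriented_hom ?f D H"
    by (simp add: improper_oriented_hom_def)
  with refl show ?thesis by (auto simp: oriented_improper_hom_exists_def)
qed


section \<open>2-edge-coloured graphs\<close>

lemma coloured_edgeE:
  assumes "two_edge_coloured_graph G" "(e, c) \<in> cedges G"
  obtains u v where "e = {u, v}" "u \<in> cverts G" "v \<in> cverts G"
  using assms by (fastforce simp: two_edge_coloured_graph_def)

lemma coloured_edge_unique:
  assumes "two_edge_coloured_graph G" "({u, v}, c) \<in> cedges G" "({u, v}, d) \<in> cedges G" "u \<noteq> v"
  shows "c = d"
  using assms by (auto simp: two_edge_coloured_graph_def)

lemma complete_convex_coloured_no_improper:
  assumes G: "two_edge_coloured_graph G" and cc: "complete_convex_coloured G"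
  shows "\<not> coloured_improper_hom_exists TYPE('b) G"
proof
  assume "coloured_improper_hom_exists TYPE('b) G"
  then obtain H :: "'b coloured_graph" and \<phi>
    where H: "reflexive_two_edge_coloured_graph H" and imp: "improper_coloured_hom \<phi> G H"
    unfolding coloured_improper_hom_exists_def by blast
  have H': "two_edge_coloured_graph H"
    using H by (simp add: reflexive_two_edge_coloured_graph_def)
  have hom: "(\<phi> ` e, c) \<in> cedges H" if "(e, c) \<in> cedges G" for e c
    using imp that by (auto simp: improper_coloured_hom_def coloured_hom_def)
  obtain e c x where e: "(e, c) \<in> cedges G" "x \<in> cverts H" "\<phi> ` e = {x}"
    using imp by (auto simp: improper_coloured_hom_def)
  let ?F = "{a \<in> cverts G. \<phi> a = x}"
  have "path_convex (cverts G) (alternating_two_path G) ?F"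
  proof -
    have False if "({a, b}, c) \<in> cedges G" "({b, a'}, d) \<in> cedges G" "c \<noteq> d"
      "\<phi> a = x" "\<phi> a' = x" "\<phi> b \<noteq> x" for a b a' c d
    proof -
      \<comment> \<open>Both edges land on the same pair with different colours. Only a loop may
        carry two colours, and \<open>\<phi> b\<close> differs from \<open>x\<close>.\<close>
      have "({x, \<phi> b}, c) \<in> cedges H" "({x, \<phi> b}, d) \<in> cedges H"
        using hom[OF that(1)] hom[OF that(2)] that(4,5) by (simp_all add: insert_commute)
      then show False using coloured_edge_unique[OF H'] that(3,6) by metis
    qed
    then show ?thesis
      unfolding path_convex_def alternating_two_path_def by blast
  qed
  moreover have "e \<subseteq> ?F" using e coloured_edgeE[OF G e(1)] by auto
  ultimately have "conv (cverts G) (alternating_two_path G) e \<subseteq> ?F"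
    by (auto simp: conv_def)
  moreover have "conv (cverts G) (alternating_two_path G) e = cverts G"
    using cc e by (auto simp: complete_convex_coloured_def)
  ultimately have const: "\<phi> a = x" if "a \<in> cverts G" for a
    using that by auto
  have "\<phi> ` e' = {x}" if "(e', c') \<in> cedges G" for e' c'
    by (rule coloured_edgeE[OF G that]) (simp add: const)
  then have "trivial_coloured_hom \<phi> G H"
    using imp e(2) unfolding improper_coloured_hom_def trivial_coloured_hom_def by blast
  with imp show False by (simp add: improper_coloured_hom_def)
qed

lemma not_complete_convex_coloured_improper:
  fixes G :: "'a coloured_graph"
  assumes G: "two_edge_coloured_graph G" and ncc: "\<not> complete_convex_coloured G"
  shows "coloured_improper_hom_exists TYPE('a) G"
proof -
  obtain e c where e: "(e, c) \<in> cedges G" "conv (cverts G) (alternating_two_path G) e \<noteq> cverts G"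
    using ncc unfolding complete_convex_coloured_def by blast
  obtain u v where uv: "e = {u, v}" and sub: "{u, v} \<subseteq> cverts G"
    by (rule coloured_edgeE[OF G e(1)]) simp
  define S where "S = conv (cverts G) (alternating_two_path G) {u, v}"
  obtain z where z: "z \<in> cverts G" "z \<notin> S"
    using conv_proper_vertex[OF sub] e(2) by (auto simp: S_def uv)
  have uS: "u \<in> S" "v \<in> S" and conv: "path_convex (cverts G) (alternating_two_path G) S"
    using conv_smallest_convex(1,2)[OF sub] by (auto simp: S_def)
  have no_alternating: "c = d"
    if "({a, b}, c) \<in> cedges G" "({b, a'}, d) \<in> cedges G" "a \<in> S" "a' \<in> S" "b \<notin> S" for a b a' c d
  proof (rule ccontr)
    assume "c \<noteq> d"
    then have "alternating_two_path G a b a'"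
      using that by (auto simp: alternating_two_path_def)
    moreover have "b \<in> cverts G"
      using coloured_edgeE[OF G that(1)] by (auto simp: doubleton_eq_iff)
    ultimately show False using conv that unfolding path_convex_def by blast
  qed
  let ?f = "contract S u"
  define H where "H = \<lparr>cverts = ?f ` cverts G,
    cedges = {(?f ` e, c) | e c. (e, c) \<in> cedges G} \<union> {({x}, c) | x c. x \<in> ?f ` cverts G}\<rparr>"
  have ends: "\<exists>x \<in> cverts H. \<exists>y \<in> cverts H. e = {x, y}" if "(e, c) \<in> cedges H" for e c
    using that by (auto simp: H_def elim!: coloured_edgeE[OF G])
  have unique: "c = d"
    if xy: "x \<noteq> y" "({x, y}, c) \<in> cedges H" "({x, y}, d) \<in> cedges H" for x y c d
  proof -
    \<comment> \<open>Distinct ends rule out the added loops. Edges are unordered, so the ends of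
      the preimage may have to be swapped to lie over \<open>x\<close> and \<open>y\<close> in this
      order.\<close>
    have lift: "\<exists>a b. ({a, b}, c) \<in> cedges G \<and> ?f a = x \<and> ?f b = y"
      if "x \<noteq> y" "({x, y}, c) \<in> cedges H" for x y c
    proof -
      have "(\<exists>e. (e, c) \<in> cedges G \<and> {x, y} = ?f ` e) \<or> (\<exists>z. {x, y} = {z})"
        using that(2) unfolding H_def by simp blast
      moreover have "{x, y} \<noteq> {z}" for z using that(1) by auto
      ultimately obtain e where e: "(e, c) \<in> cedges G" "?f ` e = {x, y}" by metis
      obtain a b where ab: "e = {a, b}" by (rule coloured_edgeE[OF G e(1)])
      then have "?f a = x \<and> ?f b = y \<or> ?f b = x \<and> ?f a = y"
        using e(2) by (auto simp: doubleton_eq_iff)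
      then show ?thesis using e(1) ab by (metis insert_commute)
    qed
    obtain a b where ab: "({a, b}, c) \<in> cedges G" "?f a = x" "?f b = y"
      using lift[OF xy(1,2)] by blast
    obtain a' b' where ab': "({a', b'}, d) \<in> cedges G" "?f a' = x" "?f b' = y"
      using lift[OF xy(1,3)] by blast
    have "a \<noteq> b" "\<not> (a \<in> S \<and> b \<in> S)"
      using ab \<open>x \<noteq> y\<close> by auto
    moreover have "a = a' \<or> a \<in> S \<and> a' \<in> S" "b = b' \<or> b \<in> S \<and> b' \<in> S"
      using ab ab' by (metis contract_eq_iff uS(1))+
    \<comment> \<open>Either end may be the one outside \<open>S\<close>; having both orders of the
      ends lets \<open>no_alternating\<close> apply with centre \<open>a\<close> or
      \<open>b\<close>. If neither end class is \<open>S\<close>, the lifts coincide and uniqueness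
      of the colour in \<open>G\<close> decides.\<close>
    moreover have "({b, a}, c) \<in> cedges G" "({b', a'}, d) \<in> cedges G"
      using ab(1) ab'(1) by (simp_all add: insert_commute)
    ultimately show ?thesis
      using ab(1) ab'(1) no_alternating coloured_edge_unique[OF G] by metis
  qed
  have conn: "connected (with_proj (underlying H))"
  proof (rule connected_image)
    show "connected (with_proj (underlying G))"
      using G by (simp add: two_edge_coloured_graph_def)
    show "(?f a, ?f b) \<in> parcs (underlying H)" if ab: "(a, b) \<in> parcs (underlying G)" for a b
    proof -
      obtain c where "({a, b}, c) \<in> cedges G" using ab by (auto simp: underlying_def)
      then have "(?f ` {a, b}, c) \<in> cedges H" unfolding H_def by auto
      then show ?thesis by (auto simp: underlying_def)
    qed
  qed (simp add: underlying_def H_def)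
  have verts: "u \<in> cverts H" "z \<in> cverts H" "u \<noteq> z"
    using sub uS z by (force simp: H_def)+
  have "two_edge_coloured_graph H"
    unfolding two_edge_coloured_graph_def
  proof (intro conjI)
    show "\<forall>(e, c) \<in> cedges H. \<exists>x \<in> cverts H. \<exists>y \<in> cverts H. e = {x, y}"
      using ends by fast
    show "\<forall>x y c d. x \<noteq> y \<longrightarrow> ({x, y}, c) \<in> cedges H \<longrightarrow> ({x, y}, d) \<in> cedges H \<longrightarrow> c = d"
      using unique by fast
    show "\<exists>x \<in> cverts H. \<exists>y \<in> cverts H. x \<noteq> y"
      using verts by fast
  qed (rule conn)
  moreover have "({x}, c) \<in> cedges H" if "x \<in> cverts H" for x c
    using that by (auto simp: H_def)
  ultimately have refl: "reflexive_two_edge_coloured_graph H"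
    by (simp add: reflexive_two_edge_coloured_graph_def)
  obtain w where "(z, w) \<in> parcs (underlying G) \<or> (w, z) \<in> parcs (underlying G)"
    using connected_vertex_incident[of "underlying G" z u] G sub z uS
    by (auto simp: two_edge_coloured_graph_def underlying_def)
  then obtain d where d: "({z, w}, d) \<in> cedges G"
    by (auto simp: underlying_def insert_commute)
  have "\<not> trivial_coloured_hom ?f G H"
  proof
    assume "trivial_coloured_hom ?f G H"
    then obtain x where "\<forall>(e, c) \<in> cedges G. ?f ` e = {x}"
      by (auto simp: trivial_coloured_hom_def)
    \<comment> \<open>The first image is \<open>{u}\<close> and the second contains
      \<open>z\<close>, which lies outside \<open>S\<close>.\<close>
    then have "?f ` {u, v} = {x}" "?f ` {z, w} = {x}" using e(1) d uv by auto
    then show False using uS z by auto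
  qed
  moreover have "coloured_hom ?f G H"
    by (auto simp: coloured_hom_def H_def)
  moreover have "\<exists>(e, c) \<in> cedges G. \<exists>x \<in> cverts H. ?f ` e = {x}"
    using e(1) uv uS \<open>u \<in> cverts H\<close> by (auto intro!: bexI[of _ "(e, c)"])
  ultimately have "improper_coloured_hom ?f G H"
    by (simp add: improper_coloured_hom_def)
  with refl show ?thesis by (auto simp: coloured_improper_hom_exists_def)
qed

text \<open>The contraction has its vertices in \<open>'a\<close>, so targets over \<open>'a\<close>
  already detect a failure of complete convexity. The fibre argument works over any
  \<open>'b\<close>. A one-element \<open>'b\<close> has no targets at all, so the equivalence is
  stated over \<open>'a\<close>.\<close>

theorem theorem2:
  fixes D :: "'a pair_pre_digraph" and G :: "'a coloured_graph"
  shows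
    "(oriented_graph D \<longrightarrow>
        (\<not> oriented_improper_hom_exists TYPE('a) D \<longleftrightarrow> complete_convex_oriented D) \<and>
        (complete_convex_oriented D \<longrightarrow> \<not> oriented_improper_hom_exists TYPE('b) D)) \<and>
     (two_edge_coloured_graph G \<longrightarrow>
        (\<not> coloured_improper_hom_exists TYPE('a) G \<longleftrightarrow> complete_convex_coloured G) \<and>
        (complete_convex_coloured G \<longrightarrow> \<not> coloured_improper_hom_exists TYPE('b) G))"
  using complete_convex_oriented_no_improper[of D, where 'b = 'a]
    complete_convex_oriented_no_improper[of D, where 'b = 'b]
    not_complete_convex_oriented_improper[of D]
    complete_convex_coloured_no_improper[of G, where 'b = 'a]
    complete_convex_coloured_no_improper[of G, where 'b = 'b]
    not_complete_convex_coloured_improper[of G]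
  by argo

end
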